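(* Let $(\mathbb{K},|\cdot|)$ be a complete non-Archimedean valued field with nontrivial absolute value, let $(X,\|\cdot\|)$ be an ultrametric normed space over $\mathbb{K}$, and let $(X,\{A_n\})$ be an ultrametric approximation scheme with jump function $K$. The following are equivalent: (a) $\inf_{n\in\mathbb{N}}E(B(X),A_n)=c>0$; (b) $\inf_{n\in\mathbb{N}}E(B(X),A_n)\ge p_{\mathbb{K}}^3>0$. Furthermore, if $E(B(X),A_m)<p_{\mathbb{K}}^3$ for some $m\in\mathbb{N}$ and there is $C>0$ with $K(n)\le Cn$ for all $n$, then $E(B(X),A_n)=\mathbf{O}\big(\tau^{n^{1/\log_2 C}}\big)$ for some $0<\tau<1$. In particular, if $C\le 2$ then $\{E(B(X),A_n)\}$ decays exponentially to zero.
   Context: $p_{\mathbb{K}}=\sup\{|\lambda|:\lambda\in\mathbb{K},|\lambda|<1\}$. An ultrametric approximation scheme $(X,\{A_n\})$ consists of an infinite chain $\{0\}=A_0\subset A_1\subset\cdots\subset X$ of subsets with all inclusions strict, such that: (i) there is a map $K:\mathbb{N}\to\mathbb{N}$ (the jump function) with $K(n)\ge n$ and $A_n+A_n\subseteq A_{K(n)}$ for all $n$; (ii) $\lambda A_n\subseteq A_n$ for all $n$ and $\lambda\in\mathbb{K}$; (iii) $\bigcup_n A_n$ is dense in $X$. $E(x,A)=\inf_{a\in A}\|x-a\|$, $E(B,A)=\sup_{b\in B}E(b,A)$, $B(X)=\{x\in X:\|x\|\le1\}$. *)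

theory Defs
  imports "HOL-Analysis.Analysis" "HOL-Library.Landau_Symbols"
begin

text \<open>
  The library's normed fields and spaces are real normed, hence Archimedean, so absolute values and
  ultrametric norms are explicit real-valued functions here.
\<close>

locale nonarch_valued_field =
  fixes av :: "'k::field \<Rightarrow> real"
  assumes av_nonneg: "0 \<le> av x"
    and av_eq_0_iff: "av x = 0 \<longleftrightarrow> x = 0"
    and av_mult: "av (x * y) = av x * av y"
    and av_ultrametric: "av (x + y) \<le> max (av x) (av y)"
begin

lemma av_one: "av 1 = 1"
  using av_mult[of 1 1] av_eq_0_iff[of 1] by simp

lemma av_minus: "av (- x) = av x"
proof -
  have "av (- 1) * av (- 1) = 1"
    using av_mult[of "- 1" "- 1"] by (simp add: av_one)
  then have "av (- 1) = 1"
    using av_nonneg[of "- 1"] by (auto simp: square_eq_1_iff)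
  then show ?thesis
    using av_mult[of "- 1" x] by simp
qed

lemma Metric_space_av: "Metric_space UNIV (\<lambda>x y. av (x - y))"
proof
  fix x y z
  show "0 \<le> av (x - y)" by (rule av_nonneg)
  show "av (x - y) = av (y - x)" using av_minus[of "x - y"] by simp
  show "(av (x - y) = 0) = (x = y)" by (simp add: av_eq_0_iff)
  show "av (x - z) \<le> av (x - y) + av (y - z)"
    using av_ultrametric[of "x - y" "y - z"] av_nonneg[of "x - y"] av_nonneg[of "y - z"] by simp
qed

end

locale complete_nontrivial_nonarch_valued_field = nonarch_valued_field av
  for av :: "'k::field \<Rightarrow> real" +
  assumes av_nontrivial: "\<exists>x. x \<noteq> 0 \<and> av x \<noteq> 1"
    and av_complete: "Metric_space.mcomplete UNIV (\<lambda>x y. av (x - y))"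

locale ultrametric_normed_space =
  complete_nontrivial_nonarch_valued_field av + vector_space scale
  for av :: "'k::field \<Rightarrow> real"
    and scale :: "'k \<Rightarrow> 'x::ab_group_add \<Rightarrow> 'x" +
  fixes nrm :: "'x \<Rightarrow> real"
  assumes nrm_nonneg: "0 \<le> nrm x"
    and nrm_eq_0_iff: "nrm x = 0 \<longleftrightarrow> x = 0"
    and nrm_scale: "nrm (scale c x) = av c * nrm x"
    and nrm_ultrametric: "nrm (x + y) \<le> max (nrm x) (nrm y)"
begin

lemma nrm_minus: "nrm (- x) = nrm x"
  using nrm_scale[of "- 1" x] by (simp add: av_minus av_one)

lemma Metric_space_nrm: "Metric_space UNIV (\<lambda>x y. nrm (x - y))"
proof
  fix x y z
  show "0 \<le> nrm (x - y)" by (rule nrm_nonneg)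
  show "nrm (x - y) = nrm (y - x)" using nrm_minus[of "x - y"] by simp
  show "(nrm (x - y) = 0) = (x = y)" by (simp add: nrm_eq_0_iff)
  show "nrm (x - z) \<le> nrm (x - y) + nrm (y - z)"
    using nrm_ultrametric[of "x - y" "y - z"] nrm_nonneg[of "x - y"] nrm_nonneg[of "y - z"] by simp
qed

end

locale ultrametric_approximation_scheme = ultrametric_normed_space av scale nrm
  for av :: "'k::field \<Rightarrow> real"
    and scale :: "'k \<Rightarrow> 'x::ab_group_add \<Rightarrow> 'x"
    and nrm :: "'x \<Rightarrow> real" +
  fixes A :: "nat \<Rightarrow> 'x set" and K :: "nat \<Rightarrow> nat"
  assumes A_0: "A 0 = {0}"
    and A_strict: "A n \<subset> A (Suc n)"
    and K_ge: "n \<le> K n"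
    and A_add: "a \<in> A n \<Longrightarrow> b \<in> A n \<Longrightarrow> a + b \<in> A (K n)"
    and A_scale: "a \<in> A n \<Longrightarrow> scale c a \<in> A n"
    and A_dense: "Metric_space.mtopology UNIV (\<lambda>x y. nrm (x - y)) closure_of (\<Union>n. A n) = UNIV"

definition p_val :: "('k \<Rightarrow> real) \<Rightarrow> real" where
  "p_val av = Sup {av c |c. av c < 1}"

definition unit_ball :: "('x \<Rightarrow> real) \<Rightarrow> 'x set" where
  "unit_ball nrm = {x. nrm x \<le> 1}"

definition approx_err :: "('x::ab_group_add \<Rightarrow> real) \<Rightarrow> 'x \<Rightarrow> 'x set \<Rightarrow> real" where
  "approx_err nrm x S = (INF a\<in>S. nrm (x - a))"

text \<open>
  The supremum below is taken in the reals, so it is meaningful only when the errors are bounded on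
  \<open>B\<close>. This is the case for \<open>B = unit_ball nrm\<close> and any \<open>S\<close> containing \<open>0\<close>, where they are at
  most \<open>1\<close>.
\<close>

definition approx_dev :: "('x::ab_group_add \<Rightarrow> real) \<Rightarrow> 'x set \<Rightarrow> 'x set \<Rightarrow> real" where
  "approx_dev nrm B S = (SUP b\<in>B. approx_err nrm b S)"

end

(*
  Write D n for the deviation of the unit ball from A n, and p for p_val av. For q < p every r > 0
  satisfies r <= |c| <= r / q for some scalar c. If a in A n approximates x in the unit ball, rescale
  x - a by such a c into the unit ball and approximate it once more; letting q tend to p gives
  p * D (K n) <= (D n)^2. So once D m < p, which is implied by D m < p^3 as p <= 1, the values
  D (K^j m) decay like theta^(2^j) with theta < 1. This proves the dichotomy, and the growth bound
  K^j m <= C^j * m turns it into the stated rate.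
*)

theory Submission
  imports Defs
begin

section \<open>Absolute values of scalars and the constant \<open>p_val av\<close>\<close>

context complete_nontrivial_nonarch_valued_field
begin

lemma av_zero: "av 0 = 0"
  using av_eq_0_iff by simp

lemma av_inverse: "av (inverse x) = inverse (av x)"
proof (cases "x = 0")
  case False
  then have "av x * av (inverse x) = 1"
    using av_mult[of x "inverse x"] by (simp add: av_one)
  then show ?thesis
    by (simp add: inverse_unique)
qed (simp add: av_zero)

lemma av_power: "av (x ^ n) = av x ^ n"
  by (induction n) (simp_all add: av_one av_mult)

lemma av_power_int: "av (x powi k) = av x powi k"
  by (simp add: power_int_def av_power av_inverse)

lemma p_val_upper: "av c < 1 \<Longrightarrow> av c \<le> p_val av"
  unfolding p_val_def by (rule cSup_upper) (auto intro!: bdd_aboveI[of _ 1])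

text \<open>Nontriviality gives a nonzero scalar of absolute value other than 1; it or its inverse
  has absolute value strictly between 0 and 1.\<close>

lemma p_val_pos: "0 < p_val av"
proof -
  obtain x where x: "x \<noteq> 0" "av x \<noteq> 1"
    using av_nontrivial by blast
  then have "0 < av x"
    using av_nonneg[of x] av_eq_0_iff[of x] by linarith
  define y where "y = (if av x < 1 then x else inverse x)"
  have "0 < av y" "av y < 1"
    using x \<open>0 < av x\<close> by (auto simp: y_def av_inverse inverse_less_1_iff)
  with p_val_upper show ?thesis
    by (meson less_le_trans)
qed

lemma p_val_le_1: "p_val av \<le> 1"
  unfolding p_val_def by (rule cSup_least) (auto intro: exI[of _ 0] simp: av_zero)

lemma ex_av_gt: "q < p_val av \<Longrightarrow> \<exists>c. q < av c \<and> av c < 1"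
  unfolding p_val_def
  by (subst (asm) less_cSup_iff) (auto intro: exI[of _ 0] bdd_aboveI[of _ 1] simp: av_zero)

text \<open>The powers of a scalar \<open>b\<close> with \<open>q < av b < 1\<close> have absolute
  values in geometric progression of ratio \<open>av b\<close>. Since \<open>q < av b\<close>, the
  interval from \<open>r\<close> to \<open>r / q\<close> is too long to fit between two consecutive
  ones.\<close>

lemma ex_av_between:
  assumes q: "0 < q" "q < p_val av" and r: "0 < r"
  shows "\<exists>c. r \<le> av c \<and> av c \<le> r / q"
proof -
  obtain b where b: "q < av b" "av b < 1"
    using ex_av_gt q by blast
  \<comment> \<open>The base is below 1, so rounding the exponent down keeps the power at least
    \<open>r\<close>, and overshoots by at most the factor \<open>1 / av b\<close>.\<close>
  define k where "k = \<lfloor>log (av b) r\<rfloor>"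
  have "0 < av b"
    using b q by linarith
  have lo: "r \<le> av b powr real_of_int k"
  proof -
    have "av b powr log (av b) r \<le> av b powr real_of_int k"
      using b \<open>0 < av b\<close> unfolding k_def by (intro powr_mono') auto
    then show ?thesis
      using b r \<open>0 < av b\<close> by simp
  qed
  have "av b powr (real_of_int k + 1) \<le> av b powr log (av b) r"
    using b \<open>0 < av b\<close> unfolding k_def by (intro powr_mono') linarith+
  then have "av b powr real_of_int k * av b \<le> r"
    using b r \<open>0 < av b\<close> by (simp add: powr_add)
  moreover have "av b powr real_of_int k * q \<le> av b powr real_of_int k * av b"
    using b by (intro mult_left_mono) auto
  ultimately have "av b powr real_of_int k \<le> r / q"
    using q by (simp add: pos_le_divide_eq)
  with lo show ?thesis
    using \<open>0 < av b\<close> by (intro exI[of _ "b powi k"]) (simp add: av_power_int powr_real_of_int')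
qed

end

section \<open>Approximation errors and deviations of the unit ball\<close>

context ultrametric_approximation_scheme
begin

abbreviation dev :: "nat \<Rightarrow> real" where
  "dev n \<equiv> approx_dev nrm (unit_ball nrm) (A n)"

lemma A_mono: "m \<le> n \<Longrightarrow> A m \<subseteq> A n"
  by (rule lift_Suc_mono_le[of A]) (simp_all add: A_strict psubset_imp_subset)

lemma zero_in_A: "0 \<in> A n"
  using A_mono[of 0 n] A_0 by auto

lemma nrm_zero: "nrm 0 = 0"
  using nrm_eq_0_iff by simp

lemma approx_err_le: "a \<in> A n \<Longrightarrow> approx_err nrm x (A n) \<le> nrm (x - a)"
  unfolding approx_err_def by (rule cINF_lower) (auto intro!: bdd_belowI[of _ 0] nrm_nonneg)

lemma approx_err_nonneg: "0 \<le> approx_err nrm x (A n)"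
  unfolding approx_err_def using zero_in_A nrm_nonneg by (intro cINF_greatest) auto

lemma ex_approximant: "approx_err nrm x (A n) < d \<Longrightarrow> \<exists>a\<in>A n. nrm (x - a) < d"
  unfolding approx_err_def using zero_in_A
  by (subst (asm) cINF_less_iff) (auto intro!: bdd_belowI[of _ 0] nrm_nonneg)

lemma approx_err_le_dev: "nrm x \<le> 1 \<Longrightarrow> approx_err nrm x (A n) \<le> dev n"
proof -
  assume "nrm x \<le> 1"
  \<comment> \<open>Approximating by 0 bounds the errors, so the real supremum in
    \<open>approx_dev\<close> is a genuine one.\<close>
  have "approx_err nrm y (A n) \<le> 1" if "nrm y \<le> 1" for y
    using approx_err_le[OF zero_in_A, of y n] that by simp
  then show ?thesis
    unfolding approx_dev_def using \<open>nrm x \<le> 1\<close>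
    by (intro cSUP_upper) (auto simp: unit_ball_def intro!: bdd_aboveI[of _ 1])
qed

lemma dev_le: "(\<And>x. nrm x \<le> 1 \<Longrightarrow> approx_err nrm x (A n) \<le> d) \<Longrightarrow> dev n \<le> d"
  unfolding approx_dev_def
  by (rule cSUP_least) (auto simp: unit_ball_def nrm_zero intro: exI[of _ 0])

lemma dev_nonneg: "0 \<le> dev n"
  using approx_err_nonneg[of 0 n] approx_err_le_dev[of 0 n] by (simp add: nrm_zero)

lemma dev_antimono: "m \<le> n \<Longrightarrow> dev n \<le> dev m"
proof (rule dev_le)
  fix x
  assume "m \<le> n" "nrm x \<le> 1"
  have "approx_err nrm x (A n) \<le> approx_err nrm x (A m)"
    unfolding approx_err_def using A_mono[OF \<open>m \<le> n\<close>] zero_in_A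
    by (intro cINF_superset_mono) (auto intro!: bdd_belowI[of _ 0] nrm_nonneg)
  also have "\<dots> \<le> dev m"
    by (rule approx_err_le_dev) fact
  finally show "approx_err nrm x (A n) \<le> dev m" .
qed

section \<open>The quadratic inequality for one jump\<close>

lemma approx_err_jump_le:
  assumes q: "0 < q" "q < p_val av" and d: "dev n < d" and x: "nrm x \<le> 1"
  shows "approx_err nrm x (A (K n)) \<le> d * d / q"
proof -
  have "0 < d"
    using d dev_nonneg[of n] by linarith
  \<comment> \<open>The infimum over \<open>A n\<close> need not be attained, hence the slack
    between \<open>dev n\<close> and \<open>d\<close>.\<close>
  obtain a where a: "a \<in> A n" "nrm (x - a) < d"
    using ex_approximant[of x n d] approx_err_le_dev[OF x, of n] d by force
  show ?thesis
  proof (cases "x = a")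
    case True
    \<comment> \<open>There is nothing to rescale here, but the error is already 0.\<close>
    then have "x \<in> A (K n)"
      using a A_mono[OF K_ge] by blast
    then have "approx_err nrm x (A (K n)) \<le> 0"
      using approx_err_le[of x "K n" x] by (simp add: nrm_zero)
    also have "0 \<le> d * d / q"
      using q \<open>0 < d\<close> by simp
    finally show ?thesis .
  next
    case False
    then have r: "0 < nrm (x - a)"
      using nrm_nonneg[of "x - a"] nrm_eq_0_iff[of "x - a"] by simp
    then obtain c where c: "nrm (x - a) \<le> av c" "av c \<le> nrm (x - a) / q"
      using ex_av_between q by blast
    have "c \<noteq> 0"
      using c r av_zero by auto
    define y where "y = scale (inverse c) (x - a)"
    have xa: "x - a = scale c y"
      using \<open>c \<noteq> 0\<close> by (simp add: y_def)
    have "nrm y \<le> 1"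
      using c r unfolding y_def nrm_scale av_inverse by (simp add: field_simps)
    then obtain b where b: "b \<in> A n" "nrm (y - b) < d"
      using ex_approximant[of y n d] approx_err_le_dev[of y n] d by force
    \<comment> \<open>\<open>A n\<close> is closed under scalars, so the corrected approximant is a
      sum of two elements of \<open>A n\<close>; this is the only cost of the second
      approximation.\<close>
    have "approx_err nrm x (A (K n)) \<le> nrm (x - (a + scale c b))"
      using a b A_add A_scale by (intro approx_err_le) blast
    also have "x - (a + scale c b) = scale c (y - b)"
      using xa by (simp add: scale_right_diff_distrib algebra_simps)
    also have "nrm \<dots> = av c * nrm (y - b)"
      by (rule nrm_scale)
    also have "\<dots> \<le> (d / q) * d"
    proof (rule mult_mono)
      have "nrm (x - a) / q \<le> d / q"
        using a q by (intro divide_right_mono) auto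
      then show "av c \<le> d / q"
        using c by linarith
    qed (use b q \<open>0 < d\<close> nrm_nonneg in auto)
    finally show ?thesis
      by simp
  qed
qed

text \<open>The slack is removed by two one-sided limits: first \<open>d\<close> decreases to
  \<open>dev n\<close>, then \<open>q\<close> increases to \<open>p_val av\<close>.\<close>

lemma dev_jump_le: "p_val av * dev (K n) \<le> dev n * dev n"
proof -
  have *: "q * dev (K n) \<le> d * d" if "0 < q" "q < p_val av" "dev n < d" for q d
    using dev_le[of "K n" "d * d / q"] approx_err_jump_le[OF that] that
    by (simp add: field_simps)
  have **: "q * dev (K n) \<le> dev n * dev n" if "0 < q" "q < p_val av" for q
  proof (rule tendsto_lowerbound[of "\<lambda>d. d * d" _ "at_right (dev n)"])
    show "\<forall>\<^sub>F d in at_right (dev n). q * dev (K n) \<le> d * d"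
      using *[OF that] by (auto simp: eventually_at_filter)
  qed (auto intro!: tendsto_intros)
  show ?thesis
  proof (rule tendsto_upperbound[of "\<lambda>q. q * dev (K n)" _ "at_left (p_val av)"])
    show "\<forall>\<^sub>F q in at_left (p_val av). q * dev (K n) \<le> dev n * dev n"
      using eventually_at_left_real[OF p_val_pos] by eventually_elim (use ** in auto)
  qed (auto intro!: tendsto_intros)
qed

text \<open>Measured in units of \<open>p_val av\<close>, each jump at least squares the deviation,
  so the exponent of \<theta> doubles.\<close>

lemma dev_iterate_le:
  assumes "dev m \<le> p_val av * \<theta>" and "0 \<le> \<theta>"
  shows "dev ((K ^^ j) m) \<le> p_val av * \<theta> ^ 2 ^ j"
proof (induction j)
  case (Suc j)
  have "p_val av * dev ((K ^^ Suc j) m) \<le> dev ((K ^^ j) m) * dev ((K ^^ j) m)"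
    using dev_jump_le by simp
  also have "\<dots> \<le> (p_val av * \<theta> ^ 2 ^ j) * (p_val av * \<theta> ^ 2 ^ j)"
    using Suc dev_nonneg assms p_val_pos by (intro mult_mono) auto
  also have "\<dots> = p_val av * (p_val av * \<theta> ^ 2 ^ Suc j)"
    by (simp add: power_add[symmetric] mult_2 mult_ac)
  finally show ?case
    using p_val_pos by simp
qed (use assms in simp)

section \<open>The dichotomy for the infimum of the deviations\<close>

lemma p_val_cube_le: "p_val av ^ 3 \<le> p_val av"
  using power_decreasing[of 1 3 "p_val av"] p_val_pos p_val_le_1 by simp

lemma ex_contraction:
  assumes "dev m < p_val av"
  obtains \<theta> where "0 < \<theta>" "\<theta> < 1" "dev m \<le> p_val av * \<theta>"
proof
  \<comment> \<open>The arbitrary 1/2 keeps \<theta> positive when \<open>dev m\<close> is 0, since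
    \<theta> later serves as a base of \<open>powr\<close>.\<close>
  define \<theta> where "\<theta> = max (1 / 2) (dev m / p_val av)"
  show "0 < \<theta>"
    unfolding \<theta>_def by auto
  show "\<theta> < 1"
    unfolding \<theta>_def using assms p_val_pos by (auto simp: field_simps)
  have "dev m / p_val av \<le> \<theta>"
    unfolding \<theta>_def by auto
  then show "dev m \<le> p_val av * \<theta>"
    using p_val_pos by (simp add: field_simps)
qed

lemma INF_dev_eq_0:
  assumes "dev m < p_val av"
  shows "(INF n. dev n) = 0"
proof (rule antisym)
  obtain \<theta> where \<theta>: "0 < \<theta>" "\<theta> < 1" "dev m \<le> p_val av * \<theta>"
    using ex_contraction assms by blast
  have "(INF n. dev n) \<le> p_val av * \<theta> ^ j" for j
  proof -
    have "(INF n. dev n) \<le> dev ((K ^^ j) m)"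
      by (rule cINF_lower) (auto intro!: bdd_belowI[of _ 0] dev_nonneg)
    also have "\<dots> \<le> p_val av * \<theta> ^ 2 ^ j"
      using dev_iterate_le \<theta> by simp
    \<comment> \<open>By \<open>j <= 2 ^ j\<close>; a geometric bound suffices for the
      limit.\<close>
    also have "\<dots> \<le> p_val av * \<theta> ^ j"
      using \<theta> p_val_pos by (intro mult_left_mono power_decreasing) (auto simp: less_imp_le)
    finally show ?thesis .
  qed
  moreover have "(\<lambda>j. p_val av * \<theta> ^ j) \<longlonglongrightarrow> p_val av * 0"
    using \<theta> by (intro tendsto_intros LIMSEQ_power_zero) auto
  ultimately show "(INF n. dev n) \<le> 0"
    using LIMSEQ_le_const by fastforce
  show "0 \<le> (INF n. dev n)"
    by (rule cINF_greatest) (auto intro: dev_nonneg)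
qed

text \<open>One value below \<open>p_val av\<close> makes the infimum 0, so a positive infimum
  forces every value up to \<open>p_val av\<close>, which dominates its cube.\<close>

lemma INF_dev_pos_iff:
  "0 < (INF n. dev n) \<longleftrightarrow> p_val av ^ 3 \<le> (INF n. dev n) \<and> 0 < p_val av ^ 3"
proof
  assume pos: "0 < (INF n. dev n)"
  have "p_val av ^ 3 \<le> dev n" for n
    using INF_dev_eq_0[of n] pos p_val_cube_le by linarith
  then show "p_val av ^ 3 \<le> (INF n. dev n) \<and> 0 < p_val av ^ 3"
    using p_val_pos by (auto intro: cINF_greatest)
qed linarith

section \<open>Decay rates under linear growth of the jump function\<close>

lemma iterate_jump_le:
  assumes "\<And>n. real (K n) \<le> C * real n" and "0 \<le> C"
  shows "real ((K ^^ j) m) \<le> C ^ j * real m"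
proof (induction j)
  case (Suc j)
  have "real ((K ^^ Suc j) m) \<le> C * real ((K ^^ j) m)"
    using assms by simp
  also have "\<dots> \<le> C * (C ^ j * real m)"
    using Suc assms by (intro mult_left_mono) auto
  finally show ?case
    by (simp add: mult_ac)
qed simp

text \<open>Serves the case \<open>C = 1\<close>, where \<open>K\<close> is squeezed to the
  identity. With \<open>D = dev n\<close> and \<open>p = p_val av\<close>, the jump inequality
  becomes \<open>p * D <= D * D\<close>, which for \<open>0 <= D < p\<close> leaves only
  \<open>D = 0\<close>.\<close>

lemma dev_eventually_0:
  assumes "dev m < p_val av" and "\<And>n. real (K n) \<le> real n" and "m \<le> n"
  shows "dev n = 0"
proof -
  have "K n = n"
    using assms(2)[of n] K_ge[of n] by simp
  have "dev n < p_val av"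
    using dev_antimono[OF assms(3)] assms(1) by linarith
  moreover have "(p_val av - dev n) * dev n \<le> 0"
    using dev_jump_le[of n] \<open>K n = n\<close> by (simp add: algebra_simps)
  ultimately show ?thesis
    using dev_nonneg[of n] by (simp add: mult_le_0_iff)
qed

text \<open>About \<open>log C (n / M)\<close> jumps from \<open>M\<close> fit below
  \<open>n\<close>, and 2 raised to that number is
  \<open>(n / M) powr (1 / log 2 C)\<close>.\<close>

lemma dev_decay:
  assumes m: "dev m < p_val av" and K: "\<And>n. real (K n) \<le> C * real n" and C: "1 < C"
  shows "\<exists>\<tau>. 0 < \<tau> \<and> \<tau> < 1 \<and>
    (\<forall>\<^sub>F n in sequentially. dev n \<le> \<tau> powr (real n powr (1 / log 2 C)))"
proof -
  \<comment> \<open>A positive starting index is needed to divide by it; \<open>m\<close> may be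
    0.\<close>
  define M where "M = Suc m"
  define s where "s = 1 / log 2 C"
  have "0 < s"
    using C by (simp add: s_def)
  have M: "0 < real M" "dev M < p_val av"
    using m dev_antimono[of m M] by (simp_all add: M_def)
  obtain \<theta> where \<theta>: "0 < \<theta>" "\<theta> < 1" "dev M \<le> p_val av * \<theta>"
    using ex_contraction M by blast
  \<comment> \<open>The factor \<open>M powr s\<close> turns \<open>n\<close> into
    \<open>n / M\<close>; the 2 pays for rounding the number of jumps down.\<close>
  define \<alpha> where "\<alpha> = 1 / (2 * real M powr s)"
  have "0 < \<alpha>"
    using M by (simp add: \<alpha>_def)
  have "dev n \<le> (\<theta> powr \<alpha>) powr (real n powr s)" if "M \<le> n" for n
  proof -
    define t where "t = real n / real M"
    have "1 \<le> t"
      using that M by (simp add: t_def)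
    \<comment> \<open>The largest \<open>j\<close> with \<open>C ^ j * M <= n\<close>.\<close>
    define j where "j = nat \<lfloor>log C t\<rfloor>"
    have "0 \<le> log C t"
      using C \<open>1 \<le> t\<close> by simp
    then have j: "real j \<le> log C t" "log C t < real j + 1"
      unfolding j_def by linarith+
    have "C ^ j \<le> t"
      using j(1) C \<open>1 \<le> t\<close> by (simp add: le_log_iff powr_realpow)
    then have "C ^ j * real M \<le> real n"
      using M by (simp add: t_def field_simps)
    with iterate_jump_le[of C j M] K C have "(K ^^ j) M \<le> n"
      by (simp add: order_trans flip: of_nat_le_iff)
    then have "dev n \<le> dev ((K ^^ j) M)"
      by (rule dev_antimono)
    also have "\<dots> \<le> p_val av * \<theta> ^ 2 ^ j"
      using dev_iterate_le \<theta> by simp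
    also have "\<dots> \<le> \<theta> ^ 2 ^ j"
      using p_val_le_1 \<theta> by (simp add: mult_left_le_one_le p_val_pos less_imp_le)
    also have "\<dots> = \<theta> powr (2 ^ j)"
      using \<theta> powr_realpow[of \<theta> "2 ^ j"] by simp
    also have "\<dots> \<le> \<theta> powr (\<alpha> * real n powr s)"
    \<comment> \<open>As \<theta> is below 1, the claim reverses into a lower bound for the exponent
      \<open>2 ^ j\<close>.\<close>
    proof (rule powr_mono')
      have "log 2 t / log 2 C \<le> real j + 1"
        using j(2) C by (simp add: log_base_change[of 2 C t])
      moreover have "t powr s = 2 powr (log 2 t / log 2 C)"
        using \<open>1 \<le> t\<close> powr_powr[of 2 "log 2 t" s] by (simp add: s_def)
      ultimately have "t powr s \<le> 2 powr (real j + 1)"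
        by simp
      then have "t powr s / 2 \<le> 2 ^ j"
        by (simp add: powr_add powr_realpow)
      moreover have "\<alpha> * real n powr s = t powr s / 2"
        using M by (simp add: \<alpha>_def t_def powr_divide)
      ultimately show "\<alpha> * real n powr s \<le> 2 ^ j"
        by simp
    qed (use \<theta> in auto)
    finally show ?thesis
      by (simp add: powr_powr)
  qed
  moreover have "\<theta> powr \<alpha> < 1"
    using powr_less_mono'[of \<theta> 0 \<alpha>] \<theta> \<open>0 < \<alpha>\<close> by simp
  ultimately show ?thesis
    using \<theta> unfolding s_def
    by (intro exI[of _ "\<theta> powr \<alpha>"] conjI eventually_sequentiallyI[of M]) auto
qed

lemma C_ge_1:
  assumes "\<And>n. real (K n) \<le> C * real n"
  shows "1 \<le> C"
  using assms[of 1] K_ge[of 1] by simp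

text \<open>At \<open>C = 1\<close> division by \<open>log 2 1 = 0\<close> yields exponent 0, and
  the comparison function would be constant for \<open>n >= 1\<close>. The value 0 is instead the
  limit for \<open>n >= 2\<close> as \<open>C\<close> decreases to 1, and it asserts that the
  deviations eventually vanish.\<close>

lemma dev_bigo:
  assumes m: "dev m < p_val av" and K: "\<And>n. real (K n) \<le> C * real n"
  shows "\<exists>\<tau>. 0 < \<tau> \<and> \<tau> < 1 \<and>
    dev \<in> O(\<lambda>n. if C = 1 then 0 else \<tau> powr (real n powr (1 / log 2 C)))"
proof (cases "C = 1")
  case True
  have "dev n = 0" if "m \<le> n" for n
    using dev_eventually_0[OF m _ that] K True by simp
  then have "\<forall>\<^sub>F n in sequentially. norm (dev n) \<le> 1 * norm (0 :: real)"
    by (intro eventually_sequentiallyI[of m]) simp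
  then have "dev \<in> O(\<lambda>n. 0 :: real)"
    by (rule bigoI)
  with True show ?thesis
    by (intro exI[of _ "1 / 2"]) simp
next
  case False
  then have "1 < C"
    using C_ge_1 K by (metis less_eq_real_def)
  then obtain \<tau> where \<tau>: "0 < \<tau>" "\<tau> < 1"
    "\<forall>\<^sub>F n in sequentially. dev n \<le> \<tau> powr (real n powr (1 / log 2 C))"
    using dev_decay[OF m K] by blast
  have "dev \<in> O(\<lambda>n. \<tau> powr (real n powr (1 / log 2 C)))"
    using \<tau>(3) by (intro bigoI[of _ 1]) (auto simp: dev_nonneg)
  with False \<tau> show ?thesis
    by auto
qed

text \<open>For \<open>1 < C <= 2\<close> the exponent \<open>1 / log 2 C\<close> is at least 1, so
  the rate is at least geometric once \<open>n >= 1\<close>; for \<open>C = 1\<close> the comparison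
  function is 0.\<close>

lemma dev_bigo_exponential:
  assumes m: "dev m < p_val av" and K: "\<And>n. real (K n) \<le> C * real n" and C: "C \<le> 2"
  shows "\<exists>\<tau>. 0 < \<tau> \<and> \<tau> < 1 \<and> dev \<in> O(\<lambda>n. \<tau> ^ n)"
proof -
  obtain \<tau> where \<tau>: "0 < \<tau>" "\<tau> < 1"
    "dev \<in> O(\<lambda>n. if C = 1 then 0 else \<tau> powr (real n powr (1 / log 2 C)))"
    using dev_bigo[OF m K] by blast
  have "\<tau> powr (real n powr (1 / log 2 C)) \<le> \<tau> ^ n" if "C \<noteq> 1" "1 \<le> n" for n
  proof -
    have "1 < C"
      using C_ge_1[OF K] that by simp
    then have "1 \<le> 1 / log 2 C"
      using C by simp
    then have "real n powr 1 \<le> real n powr (1 / log 2 C)"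
      using that by (intro powr_mono) auto
    then have "\<tau> powr (real n powr (1 / log 2 C)) \<le> \<tau> powr real n"
      using \<tau> by (intro powr_mono') auto
    then show ?thesis
      using \<tau> by (simp add: powr_realpow)
  qed
  then have "(\<lambda>n. if C = 1 then 0 else \<tau> powr (real n powr (1 / log 2 C))) \<in> O(\<lambda>n. \<tau> ^ n)"
    using \<tau> by (intro bigoI[of _ 1] eventually_sequentiallyI[of 1]) auto
  with \<tau> show ?thesis
    using landau_o.big_trans by blast
qed

end

theorem theorem2p7:
  fixes av :: "'k::field \<Rightarrow> real"
    and scale :: "'k \<Rightarrow> 'x::ab_group_add \<Rightarrow> 'x"
    and nrm :: "'x \<Rightarrow> real"
    and A :: "nat \<Rightarrow> 'x set"
    and K :: "nat \<Rightarrow> nat"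
  assumes "ultrametric_approximation_scheme av scale nrm A K"
  shows "((\<exists>c>0. (INF n. approx_dev nrm (unit_ball nrm) (A n)) = c) \<longleftrightarrow>
          (INF n. approx_dev nrm (unit_ball nrm) (A n)) \<ge> p_val av ^ 3 \<and> p_val av ^ 3 > 0)
    \<and> (\<forall>C::real. C > 0 \<longrightarrow>
          (\<exists>m. approx_dev nrm (unit_ball nrm) (A m) < p_val av ^ 3) \<longrightarrow>
          (\<forall>n. real (K n) \<le> C * real n) \<longrightarrow>
          (\<exists>\<tau>. 0 < \<tau> \<and> \<tau> < 1 \<and>
             (\<lambda>n. approx_dev nrm (unit_ball nrm) (A n))
               \<in> O(\<lambda>n. if C = 1 then 0 else \<tau> powr (real n powr (1 / log 2 C))))
          \<and> (C \<le> 2 \<longrightarrow>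
              (\<exists>\<tau>. 0 < \<tau> \<and> \<tau> < 1 \<and>
                 (\<lambda>n. approx_dev nrm (unit_ball nrm) (A n)) \<in> O(\<lambda>n. \<tau> ^ n))))"
proof -
  interpret ultrametric_approximation_scheme av scale nrm A K
    by fact
  have lt: "dev m < p_val av" if "dev m < p_val av ^ 3" for m
    using that p_val_cube_le by linarith
  show ?thesis
  proof (intro conjI allI impI)
    show "(\<exists>c>0. (INF n. dev n) = c) \<longleftrightarrow>
        (INF n. dev n) \<ge> p_val av ^ 3 \<and> p_val av ^ 3 > 0"
      using INF_dev_pos_iff by simp
  qed (use lt dev_bigo dev_bigo_exponential in blast)+
qed

end
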